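(* Let $k$ be an algebraically closed field of characteristic $p\ge 5$ and let $(\mathfrak g,[p])$ be a finite-dimensional restricted Lie algebra over $k$. If $r(\mathfrak g)\ge 3$, then $\mathbb E(2,\mathfrak g)\neq\emptyset$ (equivalently, $\mathrm{rk}_p(\mathfrak g)\ge 2$).
   Context: A torus of $\mathfrak g$ is an abelian $p$-subalgebra on which the $p$-map is bijective. $\mathrm{Tor}(\mathfrak g)$ is the set of tori of maximal dimension. For $\mathfrak t\in\mathrm{Tor}(\mathfrak g)$ there is the root space decomposition $\mathfrak g=C_{\mathfrak g}(\mathfrak t)\oplus\bigoplus_{\alpha\in R_{\mathfrak t}}\mathfrak g_\alpha$ with $R_{\mathfrak t}\subseteq\mathfrak t^*\smallsetminus\{0\}$ the set of roots (those $\alpha\ne0$ with $\mathfrak g_\alpha=\{x:[t,x]=\alpha(t)x\ \forall t\in\mathfrak t\}\neq(0)$). The number $r(\mathfrak g):=|R_{\mathfrak t}|$ is independent of the choice of $\mathfrak t\in\mathrm{Tor}(\mathfrak g)$. $\mathbb E(r,\mathfrak g)$ is the set of $r$-dimensional subspaces $\mathfrak e\subseteq\mathfrak g$ with $[\mathfrak e,\mathfrak e]=(0)$ and $x^{[p]}=0$ for all $x\in\mathfrak e$; $\mathrm{rk}_p(\mathfrak g)=\max\{r\in\mathbb N_0:\mathbb E(r,\mathfrak g)\neq\emptyset\}$. *)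

theory Defs
  imports "HOL-Computational_Algebra.Computational_Algebra" "HOL-Library.FuncSet"
begin

text \<open>The Lie algebra is the whole type \<open>'b\<close>, with scalars in the field \<open>'a\<close>.\<close>

locale lie_algebra = vector_space scale
  for scale :: "'a::field \<Rightarrow> 'b::ab_group_add \<Rightarrow> 'b" +
  fixes lie :: "'b \<Rightarrow> 'b \<Rightarrow> 'b"
  assumes linear_lie_right: "Vector_Spaces.linear scale scale (\<lambda>y. lie x y)"
    and linear_lie_left: "Vector_Spaces.linear scale scale (\<lambda>x. lie x y)"
    and lie_self: "lie x x = 0"
    and jacobi: "lie x (lie y z) + lie y (lie z x) + lie z (lie x y) = 0"
begin

definition lie_subalgebra :: "'b set \<Rightarrow> bool" where
  "lie_subalgebra h \<longleftrightarrow> subspace h \<and> (\<forall>x\<in>h. \<forall>y\<in>h. lie x y \<in> h)"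

definition abelian :: "'b set \<Rightarrow> bool" where
  "abelian h \<longleftrightarrow> (\<forall>x\<in>h. \<forall>y\<in>h. lie x y = 0)"

text \<open>The tensor product of the Lie algebra with \<open>'a[T]\<close> is \<open>'b poly\<close>; \<open>lie_poly\<close> is its
  \<open>'a[T]\<close>-bilinear bracket.\<close>

definition lie_poly :: "'b poly \<Rightarrow> 'b poly \<Rightarrow> 'b poly" where
  "lie_poly P Q =
     (\<Sum>i\<le>degree P. \<Sum>j\<le>degree Q. monom (lie (coeff P i) (coeff Q j)) (i + j))"

text \<open>Jacobson's terms \<open>s\<^sub>i(x,y)\<close>, given for \<open>1 \<le> i < p\<close> by the identity
  \<open>(ad (x T + y))^(p - 1) (x) = (\<Sum>i. i s\<^sub>i(x,y) T^(i - 1))\<close>.\<close>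

definition jacobson_s :: "nat \<Rightarrow> 'b \<Rightarrow> 'b \<Rightarrow> 'b" where
  "jacobson_s i x y =
     scale (inverse (of_nat i))
       (coeff ((lie_poly [:y, x:] ^^ (CHAR('a) - 1)) [:x:]) (i - 1))"

definition root_space :: "'b set \<Rightarrow> ('b \<Rightarrow> 'a) \<Rightarrow> 'b set" where
  "root_space t \<alpha> = {x. \<forall>h\<in>t. lie h x = scale (\<alpha> h) x}"

text \<open>A functional on the subspace \<open>t\<close> is a function on \<open>'b\<close> that is \<open>undefined\<close> outside \<open>t\<close>,
  so that distinct functions represent distinct elements of the dual space of \<open>t\<close>.\<close>

definition dual :: "'b set \<Rightarrow> ('b \<Rightarrow> 'a) set" where
  "dual t = {\<alpha> \<in> extensional t.
     (\<forall>x\<in>t. \<forall>y\<in>t. \<alpha> (x + y) = \<alpha> x + \<alpha> y) \<and> (\<forall>c. \<forall>x\<in>t. \<alpha> (scale c x) = c * \<alpha> x)}"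

definition roots :: "'b set \<Rightarrow> ('b \<Rightarrow> 'a) set" where
  "roots t = {\<alpha> \<in> dual t. (\<exists>h\<in>t. \<alpha> h \<noteq> 0) \<and> root_space t \<alpha> \<noteq> {0}}"

end

locale restricted_lie_algebra = lie_algebra scale lie
  for scale :: "'a::field \<Rightarrow> 'b::ab_group_add \<Rightarrow> 'b" and lie :: "'b \<Rightarrow> 'b \<Rightarrow> 'b" +
  fixes pmap :: "'b \<Rightarrow> 'b"
  assumes CHAR_pos: "CHAR('a) > 0"
    and lie_pmap: "lie (pmap x) y = (lie x ^^ CHAR('a)) y"
    and pmap_scale: "pmap (scale c x) = scale (c ^ CHAR('a)) (pmap x)"
    and pmap_add: "pmap (x + y) = pmap x + pmap y + (\<Sum>i = 1..<CHAR('a). jacobson_s i x y)"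
begin

definition p_subalgebra :: "'b set \<Rightarrow> bool" where
  "p_subalgebra h \<longleftrightarrow> lie_subalgebra h \<and> (\<forall>x\<in>h. pmap x \<in> h)"

definition torus :: "'b set \<Rightarrow> bool" where
  "torus t \<longleftrightarrow> p_subalgebra t \<and> abelian t \<and> bij_betw pmap t t"

definition Tor :: "'b set set" where
  "Tor = {t. torus t \<and> (\<forall>t'. torus t' \<longrightarrow> dim t' \<le> dim t)}"

text \<open>For a finite-dimensional algebra over an algebraically closed field the number of roots is
  the same for all members of \<open>Tor\<close>, so the choice below is immaterial.\<close>

definition num_roots :: nat where
  "num_roots = card (roots (SOME t. t \<in> Tor))"

definition elementary :: "nat \<Rightarrow> 'b set set" where
  "elementary r = {e. subspace e \<and> dim e = r \<and> abelian e \<and> (\<forall>x\<in>e. pmap x = 0)}"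

definition p_rank :: nat where
  "p_rank = Max {r. elementary r \<noteq> {}}"

end

end

theory Submission
  imports Defs
begin

text \<open>Suppose that there is no elementary plane. If nonzero root vectors \<open>x\<close>, \<open>y\<close> for distinct
  nonzero roots commuted, then so would the space \<open>kx + ky + F\<close>, where \<open>F\<close> consists of the elements
  of the bicentralizer of \<open>{x, y}\<close> that centralize the torus; the \<open>p\<close>-map sends this space into \<open>F\<close>,
  hence has a two-dimensional kernel, a contradiction. So brackets of root vectors for distinct roots
  never vanish. With three roots this forces an element \<open>h\<close> such that every nonzero element of the
  prime field is an eigenvalue of \<open>ad h\<close>; as the field is algebraically closed, the eigenspaces are
  one-dimensional. The resulting subalgebra resembles the Witt algebra closely enough that
  \<open>h\<close> can be switched to \<open>h + s x\<close> with \<open>x\<close> in the eigenspace of \<open>-1\<close>, where the bracket of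
  the eigenvectors for \<open>1\<close> and \<open>-2\<close> is a multiple of \<open>x\<close> whose coefficient is a nonconstant polynomial
  in \<open>s\<close>. At a root of this polynomial the two eigenvectors commute, which is impossible.\<close>

text \<open>Families with repetitions are allowed, since the \<open>p\<close>-map may send different
  basis vectors to the same element; a repetition gives a relation with coefficients 1 and
  -1.\<close>

lemma (in finite_dimensional_vector_space) ex_linear_relation:
  assumes "finite I" "\<And>i. i \<in> I \<Longrightarrow> f i \<in> V" "dim V < card I"
  shows "\<exists>u. (\<exists>i\<in>I. u i \<noteq> 0) \<and> (\<Sum>i\<in>I. scale (u i) (f i)) = 0"
proof (cases "inj_on f I")
  case True
  have "card (f ` I) = card I"
    using True by (rule card_image)
  then have "dependent (f ` I)"
    using assms independent_card_le_dim[of "f ` I" V] by fastforce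
  then obtain u where u: "\<exists>v\<in>f ` I. u v \<noteq> 0" "(\<Sum>v\<in>f ` I. scale (u v) v) = 0"
    using dependent_finite[of "f ` I"] assms(1) by auto
  show ?thesis
    using u True by (intro exI[of _ "u \<circ> f"]) (auto simp: sum.reindex)
next
  case False
  then obtain i j where ij: "i \<in> I" "j \<in> I" "i \<noteq> j" "f i = f j"
    by (auto simp: inj_on_def)
  define u where "u = (\<lambda>k. if k = i then 1 else if k = j then -1 else (0::'a))"
  have "(\<Sum>k\<in>I. scale (u k) (f k)) = (\<Sum>k\<in>{i, j}. scale (u k) (f k))"
    using ij assms(1) by (intro sum.mono_neutral_right) (auto simp: u_def)
  also have "\<dots> = 0"
    using ij by (simp add: u_def)
  finally show ?thesis
    using ij by (intro exI[of _ u]) (auto simp: u_def)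
qed

section \<open>Bilinearity, skew symmetry and the derivation form of the Jacobi identity\<close>

context lie_algebra
begin

lemma
  shows lie_add_right: "lie x (y + z) = lie x y + lie x z"
    and lie_scale_right: "lie x (scale c y) = scale c (lie x y)"
    and lie_zero_right: "lie x 0 = 0"
    and lie_minus_right: "lie x (- y) = - lie x y"
    and lie_diff_right: "lie x (y - z) = lie x y - lie x z"
    and lie_sum_right: "lie x (sum f I) = (\<Sum>i\<in>I. lie x (f i))"
proof -
  interpret Vector_Spaces.linear scale scale "\<lambda>y. lie x y"
    by (rule linear_lie_right)
  show "lie x (y + z) = lie x y + lie x z" "lie x (scale c y) = scale c (lie x y)"
    "lie x 0 = 0" "lie x (- y) = - lie x y" "lie x (y - z) = lie x y - lie x z"
    "lie x (sum f I) = (\<Sum>i\<in>I. lie x (f i))"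
    by (rule add scale zero neg diff sum)+
qed

lemma
  shows lie_add_left: "lie (y + z) x = lie y x + lie z x"
    and lie_scale_left: "lie (scale c y) x = scale c (lie y x)"
    and lie_zero_left: "lie 0 x = 0"
    and lie_minus_left: "lie (- y) x = - lie y x"
    and lie_diff_left: "lie (y - z) x = lie y x - lie z x"
proof -
  interpret Vector_Spaces.linear scale scale "\<lambda>y. lie y x"
    by (rule linear_lie_left)
  show "lie (y + z) x = lie y x + lie z x" "lie (scale c y) x = scale c (lie y x)"
    "lie 0 x = 0" "lie (- y) x = - lie y x" "lie (y - z) x = lie y x - lie z x"
    by (rule add scale zero neg diff)+
qed

lemmas lie_bilinear =
  lie_add_right lie_scale_right lie_zero_right lie_minus_right lie_diff_right
  lie_add_left lie_scale_left lie_zero_left lie_minus_left lie_diff_left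

lemma lie_skew: "lie x y = - lie y x"
proof -
  have "lie (x + y) (x + y) = 0"
    by (rule lie_self)
  then have "lie x y + lie y x = 0"
    unfolding lie_add_left lie_add_right by (simp add: lie_self add.commute)
  then show ?thesis
    by (simp add: eq_neg_iff_add_eq_0)
qed

lemma lie_lie: "lie x (lie y z) = lie (lie x y) z + lie y (lie x z)"
proof -
  have "lie y (lie z x) = - lie y (lie x z)" "lie z (lie x y) = - lie (lie x y) z"
    by (metis lie_skew lie_minus_right)+
  then have "lie x (lie y z) + - lie y (lie x z) + - lie (lie x y) z = 0"
    using jacobi[of x y z] by simp
  then show ?thesis
    by (simp add: algebra_simps)
qed

lemma lie_root_space:
  assumes "x \<in> root_space t \<alpha>" "y \<in> root_space t \<beta>"
  shows "lie x y \<in> root_space t (\<lambda>h. \<alpha> h + \<beta> h)"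
  using assms by (auto simp: root_space_def lie_lie lie_bilinear scale_left_distrib)

lemma subspace_root_space: "subspace (root_space t \<alpha>)"
  by (auto simp: subspace_def root_space_def lie_bilinear scale_right_distrib mult.commute)

end

section \<open>The \<open>p\<close>-map on commuting elements and on root vectors\<close>

context restricted_lie_algebra
begin

lemma lie_poly_zero_right: "lie_poly P 0 = 0"
  by (simp add: lie_poly_def lie_zero_right)

lemma lie_pmap_eq_0:
  assumes "lie x y = 0"
  shows "lie (pmap x) y = 0"
proof -
  obtain q where q: "CHAR('a) = Suc q"
    using CHAR_pos gr0_implies_Suc by blast
  have "(lie x ^^ n) 0 = 0" for n
    by (induction n) (auto simp: lie_zero_right)
  then show ?thesis
    using assms by (simp add: lie_pmap q funpow_Suc_right del: funpow.simps)
qed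

text \<open>Jacobson's terms are coefficients of iterated brackets that start with the bracket of
  \<open>x T + y\<close> and \<open>x\<close>. This first bracket is already zero, and
  \<open>CHAR('a) > 1\<close> ensures that it occurs.\<close>

lemma pmap_add_commuting:
  assumes "lie x y = 0" "CHAR('a) > 1"
  shows "pmap (x + y) = pmap x + pmap y"
proof -
  obtain q where q: "CHAR('a) - 1 = Suc q"
    using assms(2) by (metis Suc_diff_Suc diff_zero One_nat_def)
  have yx: "lie y x = 0"
    using assms(1) lie_skew[of y x] by simp
  have "lie_poly [:y, x:] [:x:] = 0"
    by (cases "x = 0") (simp_all add: lie_poly_def yx lie_self lie_zero_right)
  moreover have "(lie_poly P ^^ n) 0 = 0" for P n
    by (induction n) (auto simp: lie_poly_zero_right)
  ultimately have "(lie_poly [:y, x:] ^^ (CHAR('a) - 1)) [:x:] = 0"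
    unfolding q by (simp add: funpow_Suc_right del: funpow.simps)
  then have "jacobson_s i x y = 0" for i
    by (simp add: jacobson_s_def)
  then show ?thesis
    by (simp add: pmap_add)
qed

lemma pmap_zero: "pmap 0 = 0"
  using pmap_scale[of 0 0] by (simp add: zero_power[OF CHAR_pos])

text \<open>Since \<open>lie x h\<close> is a multiple of \<open>x\<close>, a second application of
  \<open>ad x\<close> kills it, and the exponent \<open>CHAR('a)\<close> is at least 2.\<close>

lemma lie_pmap_root_space:
  assumes "x \<in> root_space t \<alpha>" "h \<in> t"
  shows "lie h (pmap x) = 0"
proof -
  have 1: "lie x h = scale (- \<alpha> h) x"
    using assms lie_skew[of x h] by (auto simp: root_space_def)
  have "(lie x ^^ n) (lie x (scale (- \<alpha> h) x)) = 0" for n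
    by (induction n) (auto simp: lie_bilinear lie_self)
  moreover obtain q where "CHAR('a) = Suc q"
    using CHAR_pos gr0_implies_Suc by blast
  moreover have "CHAR('a) \<noteq> Suc 0"
    by simp
  ultimately obtain q where q: "CHAR('a) = Suc (Suc q)"
    by (metis not0_implies_Suc)
  have "(lie x ^^ Suc (Suc q)) h = (lie x ^^ q) (lie x (lie x h))"
    by (simp add: funpow_swap1)
  then have "lie (pmap x) h = 0"
    using \<open>(lie x ^^ q) (lie x (scale (- \<alpha> h) x)) = 0\<close> 1 by (simp add: lie_pmap q del: funpow.simps)
  then show ?thesis
    using lie_skew[of h "pmap x"] by simp
qed

end

section \<open>Kernels of the \<open>p\<close>-map, commuting root vectors and pencils of linear
  maps\<close>

locale finite_dim_restricted_lie_algebra =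
  restricted_lie_algebra scale lie pmap + finite_dimensional_vector_space scale Basis
  for scale :: "'a::alg_closed_field \<Rightarrow> 'b::ab_group_add \<Rightarrow> 'b" and lie pmap Basis
begin

lemma CHAR_gt_1: "CHAR('a) > 1"
  using CHAR_pos CHAR_not_1[where 'a='a] by linarith

lemma pmap_sum_commuting:
  assumes "finite B" "\<And>x y. x \<in> B \<Longrightarrow> y \<in> B \<Longrightarrow> lie (f x) (f y) = 0"
  shows "pmap (\<Sum>b\<in>B. scale (r b) (f b)) = (\<Sum>b\<in>B. scale (r b ^ CHAR('a)) (pmap (f b)))"
  using assms
proof (induction B rule: finite_induct)
  case empty
  then show ?case by (simp add: pmap_zero)
next
  case (insert b B)
  have "lie (scale (r b) (f b)) (\<Sum>b\<in>B. scale (r b) (f b)) = 0"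
    using insert by (auto simp: lie_sum_right lie_bilinear intro!: sum.neutral)
  with insert show ?case
    by (simp add: pmap_add_commuting[OF _ CHAR_gt_1] pmap_scale)
qed

text \<open>A Frobenius-semilinear map into a space of smaller dimension has a kernel, since every
  scalar is a \<open>p\<close>-th power.\<close>

lemma ex_pmap_kernel:
  assumes "independent B" "abelian B" "pmap ` B \<subseteq> F" "dim F < card B"
  shows "\<exists>w\<in>span B. w \<noteq> 0 \<and> pmap w = 0"
proof -
  have fin: "finite B"
    using assms(1) by (rule finiteI_independent)
  obtain u where u: "\<exists>b\<in>B. u b \<noteq> 0" "(\<Sum>b\<in>B. scale (u b) (pmap b)) = 0"
    using ex_linear_relation[OF fin, of pmap F] assms by blast
  have "\<exists>r. r ^ CHAR('a) = c" for c :: 'a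
    using nth_root_exists CHAR_pos by blast
  then obtain r where r: "\<And>c::'a. r c ^ CHAR('a) = c"
    by metis
  let ?w = "\<Sum>b\<in>B. scale (r (u b)) b"
  have "pmap ?w = (\<Sum>b\<in>B. scale (r (u b) ^ CHAR('a)) (pmap b))"
    by (rule pmap_sum_commuting[OF fin, of "\<lambda>x. x"]) (use assms(2) in \<open>auto simp: abelian_def\<close>)
  then have "pmap ?w = 0"
    using u by (simp add: r)
  moreover have "?w \<noteq> 0"
  proof
    assume w: "?w = 0"
    obtain b where b: "b \<in> B" "u b \<noteq> 0"
      using u by blast
    have "r (u b) = 0"
      by (rule independentD[OF assms(1) fin subset_refl w b(1)])
    then show False
      using r[of "u b"] b by (simp add: zero_power[OF CHAR_pos])
  qed
  moreover have "?w \<in> span B"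
    by (intro span_sum span_scale span_base)
  ultimately show ?thesis by blast
qed

lemma abelian_span:
  assumes "abelian B"
  shows "abelian (span B)"
proof -
  have 1: "lie x y = 0" if "x \<in> B" "y \<in> span B" for x y
    using that(2)
    by (induction rule: span_induct_alt) (use that assms in \<open>auto simp: lie_bilinear abelian_def\<close>)
  have "lie x y = 0" if "x \<in> span B" "y \<in> span B" for x y
    using that(1)
    by (induction rule: span_induct_alt) (use that 1 in \<open>auto simp: lie_bilinear\<close>)
  then show ?thesis
    by (simp add: abelian_def)
qed

text \<open>The kernel lemma is used twice. Once a first kernel vector \<open>u\<close> is extended
  to a basis \<open>C\<close> of \<open>E\<close>, the set \<open>C - {u}\<close> still has more
  than \<open>dim F\<close> elements, so its span contains a second kernel vector, independent of
  \<open>u\<close>.\<close>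

lemma elementary_2_nonempty:
  assumes E: "subspace E" "abelian E" and "pmap ` E \<subseteq> F" and dim: "dim F + 2 \<le> dim E"
  shows "elementary 2 \<noteq> {}"
proof -
  obtain B where B: "B \<subseteq> E" "independent B" "card B = dim E"
    by (rule basis_exists)
  have "\<exists>u\<in>span B. u \<noteq> 0 \<and> pmap u = 0"
    by (rule ex_pmap_kernel[of _ F]) (use assms B in \<open>auto simp: abelian_def subset_iff\<close>)
  then obtain u where u: "u \<in> E" "u \<noteq> 0" "pmap u = 0"
    using B E(1) span_minimal by blast
  obtain C where C: "{u} \<subseteq> C" "C \<subseteq> E" "independent C" "E \<subseteq> span C"
    using maximal_independent_subset_extend[of "{u}" E] u by auto
  have cardC: "card C = dim E"
    by (rule basis_card_eq_dim) (use C in auto)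
  have "independent (C - {u})"
    using C(3) by (rule independent_mono) auto
  moreover have "card (C - {u}) = card C - 1"
    using C by (simp add: finiteI_independent)
  ultimately have "\<exists>w\<in>span (C - {u}). w \<noteq> 0 \<and> pmap w = 0"
    by (intro ex_pmap_kernel[of _ F]) (use assms C cardC in \<open>auto simp: abelian_def subset_iff image_subset_iff\<close>)
  then obtain w where w: "w \<in> span (C - {u})" "w \<noteq> 0" "pmap w = 0"
    by blast
  have "w \<in> E"
    using w(1) C(2) E(1) span_minimal[of "C - {u}" E] by blast
  then have ab: "lie u u = 0" "lie u w = 0" "lie w u = 0" "lie w w = 0"
    using E(2) u(1) by (auto simp: abelian_def)
  have "u \<notin> span {w}"
  proof
    assume "u \<in> span {w}"
    moreover have "span {w} \<subseteq> span (C - {u})"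
      using w(1) by (intro span_minimal) auto
    ultimately have "u \<in> span (C - {u})" by blast
    then show False
      using C(1,3) by (auto simp: dependent_def)
  qed
  then have "independent {u, w}" "u \<noteq> w"
    using w(2) span_base[of w "{w}"] by (auto simp: independent_insert)
  then have "dim (span {u, w}) = 2"
    by (simp add: dim_eq_card_independent)
  moreover have "abelian (span {u, w})"
    by (rule abelian_span) (use ab in \<open>auto simp: abelian_def\<close>)
  moreover have "pmap v = 0" if v: "v \<in> span {u, w}" for v
  proof -
    obtain a b where "v - scale a u = scale b w"
      using v unfolding span_breakdown_eq[of v u] span_singleton by blast
    then have "v = scale a u + scale b w"
      by (simp add: diff_eq_eq add.commute)
    then show ?thesis
      using ab by (simp add: pmap_add_commuting[OF _ CHAR_gt_1] lie_bilinear pmap_scale u w)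
  qed
  ultimately show ?thesis
    by (auto simp: elementary_def)
qed

lemma lie_root_vectors_nonzero:
  assumes el: "elementary 2 = {}"
    and x: "x \<in> root_space t \<alpha>" "x \<noteq> 0" and y: "y \<in> root_space t \<beta>" "y \<noteq> 0"
    and \<alpha>: "\<exists>h\<in>t. \<alpha> h \<noteq> 0" and \<beta>: "\<exists>h\<in>t. \<beta> h \<noteq> 0" and neq: "\<exists>h\<in>t. \<alpha> h \<noteq> \<beta> h"
  shows "lie x y \<noteq> 0"
proof
  assume xy: "lie x y = 0"
  have yx: "lie y x = 0"
    using xy lie_skew[of y x] by simp
  \<comment> \<open>The second condition makes \<open>F\<close> abelian, because elements of
    \<open>F\<close> commute with \<open>x\<close> and \<open>y\<close>. It also admits
    \<open>pmap x\<close> and \<open>pmap y\<close>, which commute with everything that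
    \<open>x\<close>, respectively \<open>y\<close>, commutes with.\<close>
  define F where "F = {c. (\<forall>h\<in>t. lie h c = 0) \<and> (\<forall>z. lie x z = 0 \<longrightarrow> lie y z = 0 \<longrightarrow> lie c z = 0)}"
  have indep0: "a = 0 \<and> b = 0" if ab: "scale a x + scale b y = 0" for a b
  proof -
    obtain h where h: "h \<in> t" "\<alpha> h \<noteq> \<beta> h"
      using neq by blast
    \<comment> \<open>The operator \<open>ad h - \<beta> h\<close> kills \<open>y\<close> and
      isolates the multiple of \<open>x\<close>.\<close>
    have "0 = lie h (scale a x + scale b y) - scale (\<beta> h) (scale a x + scale b y)"
      by (simp add: ab lie_zero_right)
    also have "\<dots> = scale (a * (\<alpha> h - \<beta> h)) x"
      using h x y by (auto simp: root_space_def lie_bilinear scale_right_distrib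
          right_diff_distrib scale_left_diff_distrib mult.commute)
    finally have "a = 0"
      using h x by simp
    then show ?thesis
      using ab y by simp
  qed
  \<comment> \<open>Elements of \<open>F\<close> are killed by \<open>t\<close>, so bracketing with
    \<open>h\<close> turns membership in \<open>F\<close> into a linear relation between
    \<open>x\<close> and \<open>y\<close>.\<close>
  have indepF: "a = 0 \<and> b = 0" if ab: "scale a x + scale b y \<in> F" for a b
  proof -
    have "a * \<alpha> h = 0 \<and> b * \<beta> h = 0" if "h \<in> t" for h
      by (rule indep0) (use that ab x y in \<open>auto simp: F_def root_space_def lie_bilinear\<close>)
    then show ?thesis
      using \<alpha> \<beta> by auto
  qed
  have F: "subspace F"
    by (auto simp: subspace_def F_def lie_bilinear)
  have cx: "lie c x = 0" "lie c y = 0" "lie x c = 0" "lie y c = 0" if "c \<in> F" for c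
    using that xy yx lie_self lie_skew[of x c] lie_skew[of y c] by (auto simp: F_def)
  have cc: "lie c d = 0" if "c \<in> F" "d \<in> F" for c d
    using that cx[of d] by (auto simp: F_def)
  define E where "E = span (insert x (insert y F))"
  have E_iff: "v \<in> E \<longleftrightarrow> (\<exists>a b. \<exists>c\<in>F. v = scale a x + scale b y + c)" for v
  proof
    assume "v \<in> E"
    then obtain a b where "v - scale a x - scale b y \<in> F"
      unfolding E_def span_breakdown_eq span_eq_iff[THEN iffD2, OF F] by blast
    then show "\<exists>a b. \<exists>c\<in>F. v = scale a x + scale b y + c"
      by (intro exI[of _ a] exI[of _ b] bexI[of _ "v - scale a x - scale b y"]) auto
  next
    assume "\<exists>a b. \<exists>c\<in>F. v = scale a x + scale b y + c"
    then show "v \<in> E"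
      unfolding E_def by (auto intro!: span_add span_scale intro: span_base)
  qed
  have "abelian E"
    unfolding E_def by (rule abelian_span) (auto simp: abelian_def cx cc xy yx lie_self)
  have pF: "pmap x \<in> F" "pmap y \<in> F"
    using lie_pmap_root_space[OF x(1)] lie_pmap_root_space[OF y(1)] lie_pmap_eq_0 by (auto simp: F_def)
  have pcF: "pmap c \<in> F" if "c \<in> F" for c
    using that lie_pmap_eq_0 lie_pmap_root_space[of c t "\<lambda>_. 0"]
    by (auto simp: F_def root_space_def)
  have "pmap ` E \<subseteq> F"
  proof safe
    fix v assume "v \<in> E"
    then obtain a b c where v: "v = scale a x + scale b y + c" and c: "c \<in> F"
      by (auto simp: E_iff)
    have "pmap v = scale (a ^ CHAR('a)) (pmap x) + scale (b ^ CHAR('a)) (pmap y) + pmap c"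
      unfolding v by (simp add: pmap_add_commuting[OF _ CHAR_gt_1] lie_bilinear xy cx[OF c] pmap_scale)
    then show "pmap v \<in> F"
      using pF pcF[OF c] F by (simp add: subspace_add subspace_scale)
  qed
  moreover have "dim F + 2 \<le> dim E"
  proof -
    have "y \<notin> span F"
      using indepF[of 0 1] F by (metis scale_one scale_zero_left add_0 span_eq_iff zero_neq_one)
    then have 1: "dim (insert y F) = dim F + 1"
      by (simp add: dim_insert)
    have "x \<notin> span (insert y F)"
    proof
      assume "x \<in> span (insert y F)"
      then obtain k where "x - scale k y \<in> F"
        unfolding span_breakdown_eq span_eq_iff[THEN iffD2, OF F] by blast
      then show False
        using indepF[of 1 "- k"] by simp
    qed
    then have "dim (insert x (insert y F)) = dim F + 2"
      using 1 by (simp add: dim_insert)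
    then show ?thesis
      by (simp add: E_def)
  qed
  ultimately show False
    using elementary_2_nonempty[OF _ \<open>abelian E\<close>, of F] el by (simp add: E_def)
qed

text \<open>\<open>A\<close> is onto, so some sequence in \<open>V\<close> satisfies \<open>A v\<^sub>n\<^sub>+\<^sub>1 = B v\<^sub>n\<close>; a linear
  relation of minimal degree between its members is a polynomial, and its roots are eigenvalues.\<close>

lemma ex_pencil_eigenvector:
  assumes V: "subspace V" "v0 \<in> V" "v0 \<noteq> 0"
    and A: "Vector_Spaces.linear scale scale A" "A ` V \<subseteq> V" "\<And>v. v \<in> V \<Longrightarrow> A v = 0 \<Longrightarrow> v = 0"
    and B: "Vector_Spaces.linear scale scale B" "B ` V \<subseteq> V"
  shows "\<exists>\<mu>. \<exists>v\<in>V. v \<noteq> 0 \<and> B v = scale \<mu> (A v)"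
proof -
  interpret A: Vector_Spaces.linear scale scale A by (rule A)
  interpret B: Vector_Spaces.linear scale scale B by (rule B)
  interpret VP: finite_dimensional_vector_space_pair_1 scale Basis scale
    by unfold_locales
  have "inj_on A V"
  proof (rule inj_onI)
    fix u w assume "u \<in> V" "w \<in> V" "A u = A w"
    then show "u = w"
      using A(3)[of "u - w"] V(1) by (simp add: A.diff subspace_diff)
  qed
  then have "dim (A ` V) = dim V"
    using V(1) by (intro VP.dim_image_eq A(1)) (simp add: span_eq_iff[THEN iffD2])
  then have "A ` V = V"
    using V(1) A(2) by (intro subspace_dim_equal A.subspace_image) auto
  then have "\<forall>w\<in>V. \<exists>u\<in>V. A u = B w"
    using B(2) by (metis image_iff image_subset_iff)
  then obtain g where g: "\<And>w. w \<in> V \<Longrightarrow> g w \<in> V \<and> A (g w) = B w"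
    by metis
  define v where "v n = (g ^^ n) v0" for n
  have v_in: "v n \<in> V" for n
    unfolding v_def by (induction n) (use V g in auto)
  have v_Suc: "A (v (Suc n)) = B (v n)" for n
    using g v_in by (simp add: v_def)
  \<comment> \<open>\<open>\<Phi> N q\<close> substitutes \<open>v i\<close> for the
    \<open>i\<close>-th power of the variable in the truncation of \<open>q\<close> at degree
    \<open>N\<close>; it does not change once \<open>N\<close> reaches
    \<open>degree q\<close>.\<close>
  define \<Phi> where "\<Phi> N q = (\<Sum>i\<le>N. scale (coeff q i) (v i))" for N q
  have \<Phi>_degree: "\<Phi> N q = \<Phi> (degree q) q" if "degree q \<le> N" for N q
    unfolding \<Phi>_def by (rule sum.mono_neutral_right) (use that in \<open>auto simp: coeff_eq_0\<close>)
  have "\<exists>u. (\<exists>i\<in>{..dim V}. u i \<noteq> 0) \<and> (\<Sum>i\<in>{..dim V}. scale (u i) (v i)) = 0"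
    by (rule ex_linear_relation[of _ _ V]) (use v_in in auto)
  then obtain u where u: "\<exists>i\<le>dim V. u i \<noteq> 0" "(\<Sum>i\<le>dim V. scale (u i) (v i)) = 0"
    by auto
  define q0 where "q0 = (\<Sum>i\<le>dim V. monom (u i) i)"
  have coeff_q0: "coeff q0 i = (if i \<le> dim V then u i else 0)" for i
    by (simp add: q0_def coeff_sum)
  have "q0 \<noteq> 0"
    using u(1) coeff_q0 by (metis coeff_0)
  moreover have "degree q0 \<le> dim V"
    by (rule degree_le) (simp add: coeff_q0)
  then have "\<Phi> (degree q0) q0 = 0"
    using u(2) by (simp add: \<Phi>_degree[symmetric]) (simp add: \<Phi>_def coeff_q0)
  ultimately obtain q where q: "q \<noteq> 0" "\<Phi> (degree q) q = 0"
    and min: "\<And>r. r \<noteq> 0 \<Longrightarrow> \<Phi> (degree r) r = 0 \<Longrightarrow> degree q \<le> degree r"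
    using ex_has_least_nat[of "\<lambda>q. q \<noteq> 0 \<and> \<Phi> (degree q) q = 0" q0 degree] by blast
  have "degree q > 0"
  proof (rule ccontr)
    assume "\<not> degree q > 0"
    then have "scale (coeff q 0) v0 = 0" "coeff q 0 \<noteq> 0"
      using q by (auto simp: \<Phi>_def v_def leading_coeff_0_iff[symmetric])
    then show False
      using V(3) by simp
  qed
  then obtain \<mu> where "poly q \<mu> = 0"
    using alg_closed_imp_poly_has_root by blast
  then obtain r where r: "q = [:-\<mu>, 1:] * r"
    by (auto simp: poly_eq_0_iff_dvd elim: dvdE)
  have "r \<noteq> 0"
    using q(1) r by auto
  then have deg: "degree q = Suc (degree r)"
    unfolding r by (subst degree_mult_eq) auto
  let ?N = "degree r"
  let ?w = "\<Phi> ?N r"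
  have "?w \<noteq> 0"
    using min[OF \<open>r \<noteq> 0\<close>] deg by auto
  moreover have "?w \<in> V"
    unfolding \<Phi>_def by (intro subspace_sum subspace_scale V v_in)
  \<comment> \<open>The relation for \<open>q\<close>, which is \<open>r\<close> times a linear
    factor, says that shifting the indices of the sequence in \<open>?w\<close> multiplies
    \<open>?w\<close> by \<open>\<mu>\<close>. Under \<open>A\<close>, each shifted vector
    \<open>v (Suc i)\<close> becomes \<open>B (v i)\<close>.\<close>
  moreover have "B ?w = scale \<mu> (A ?w)"
  proof -
    have coeff_q: "coeff q i = coeff (pCons 0 r) i - \<mu> * coeff r i" for i
      by (simp add: r)
    have "0 = \<Phi> (Suc ?N) q"
      using q(2) deg by simp
    also have "\<dots> = \<Phi> (Suc ?N) (pCons 0 r) - scale \<mu> (\<Phi> (Suc ?N) r)"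
      unfolding \<Phi>_def coeff_q scale_left_diff_distrib scale_scale[symmetric] sum_subtractf
        scale_sum_right ..
    also have "\<Phi> (Suc ?N) (pCons 0 r) = (\<Sum>i\<le>?N. scale (coeff r i) (v (Suc i)))"
      unfolding \<Phi>_def by (subst sum.atMost_Suc_shift) simp
    also have "\<Phi> (Suc ?N) r = ?w"
      by (rule \<Phi>_degree) simp
    finally have "A (\<Sum>i\<le>?N. scale (coeff r i) (v (Suc i))) = A (scale \<mu> ?w)"
      by simp
    then show ?thesis
      by (simp add: A.sum A.scale B.sum B.scale v_Suc \<Phi>_def)
  qed
  ultimately show ?thesis by blast
qed

end

section \<open>Eigenvalues and weights\<close>

lemma (in lie_algebra) lie_eigenvector:
  assumes "lie h x = scale c x" "lie h y = scale d y"
  shows "lie h (lie x y) = scale (c + d) (lie x y)"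
  using lie_root_space[of x "{h}" "\<lambda>_. c" y "\<lambda>_. d"] assms by (simp add: root_space_def)

definition (in lie_algebra) eigenvalue :: "'b \<Rightarrow> 'a \<Rightarrow> bool" where
  "eigenvalue h c \<longleftrightarrow> (\<exists>v. v \<noteq> 0 \<and> lie h v = scale c v)"

text \<open>Unlike \<open>roots\<close>, this does not ask for extensional functions, so pointwise
  sums of weights can be formed without restricting them to \<open>t\<close>.\<close>

definition (in lie_algebra) weight :: "'b set \<Rightarrow> ('b \<Rightarrow> 'a) \<Rightarrow> bool" where
  "weight t \<alpha> \<longleftrightarrow> (\<exists>x\<in>root_space t \<alpha>. x \<noteq> 0)"

locale no_elementary_plane = finite_dim_restricted_lie_algebra scale lie pmap Basis
  for scale :: "'a::alg_closed_field \<Rightarrow> 'b::ab_group_add \<Rightarrow> 'b" and lie pmap Basis +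
  assumes elementary_2_empty: "elementary 2 = {}"
    and CHAR_ge_5: "CHAR('a) \<ge> 5"
begin

lemma of_nat_neq_0: "0 < i \<Longrightarrow> i < CHAR('a) \<Longrightarrow> of_nat i \<noteq> (0::'a)"
  by (auto simp: of_nat_eq_0_iff_char_dvd dest: dvd_imp_le)

lemma numerals_neq_0: "(2::'a) \<noteq> 0" "(3::'a) \<noteq> 0" "(4::'a) \<noteq> 0"
  using of_nat_neq_0[of 2] of_nat_neq_0[of 3] of_nat_neq_0[of 4] CHAR_ge_5 by auto

text \<open>In characteristic \<open>p\<close> the set \<open>\<nat>\<close> is the prime field,
  because -1 is the image of \<open>p - 1\<close>.\<close>

lemma Nats_minus:
  assumes "(c::'a) \<in> \<nat>"
  shows "- c \<in> \<nat>"
proof -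
  have "of_nat (CHAR('a) - 1) = (-1::'a)"
    using CHAR_gt_1 by (simp add: of_nat_diff)
  then have "(-1::'a) \<in> \<nat>"
    by (metis of_nat_in_Nats)
  then show ?thesis
    using Nats_mult[of "-1" c] assms by simp
qed

lemma Nats_less_CHAR:
  assumes "(c::'a) \<in> \<nat>"
  obtains i where "i < CHAR('a)" "c = of_nat i"
proof -
  obtain j where j: "c = of_nat j"
    using assms by (rule Nats_cases)
  have "of_nat j = (of_nat (CHAR('a) * (j div CHAR('a)) + j mod CHAR('a)) :: 'a)"
    by simp
  then have "c = of_nat (j mod CHAR('a))"
    unfolding of_nat_add of_nat_mult of_nat_CHAR j by simp
  then show ?thesis
    by (intro that[of "j mod CHAR('a)"] mod_less_divisor CHAR_pos)
qed

lemma lie_eigenvectors_nonzero: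
  assumes "lie h x = scale c x" "x \<noteq> 0" "lie h y = scale d y" "y \<noteq> 0" "c \<noteq> 0" "d \<noteq> 0" "c \<noteq> d"
  shows "lie x y \<noteq> 0"
  by (rule lie_root_vectors_nonzero[where t = "{h}" and \<alpha> = "\<lambda>_. c" and \<beta> = "\<lambda>_. d"])
    (use assms elementary_2_empty in \<open>auto simp: root_space_def\<close>)

lemma eigenvalue_add:
  assumes "eigenvalue h c" "eigenvalue h d" "c \<noteq> 0" "d \<noteq> 0" "c \<noteq> d"
  shows "eigenvalue h (c + d)"
  using assms lie_eigenvector lie_eigenvectors_nonzero unfolding eigenvalue_def by metis

lemma weight_add:
  assumes "weight t f" "weight t g" "\<exists>h\<in>t. f h \<noteq> 0" "\<exists>h\<in>t. g h \<noteq> 0" "\<exists>h\<in>t. f h \<noteq> g h"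
  shows "weight t (\<lambda>h. f h + g h)"
proof -
  obtain x y where xy: "x \<in> root_space t f" "x \<noteq> 0" "y \<in> root_space t g" "y \<noteq> 0"
    using assms by (auto simp: weight_def)
  have "lie x y \<noteq> 0"
    using elementary_2_empty xy assms(3-5) by (rule lie_root_vectors_nonzero)
  then show ?thesis
    using lie_root_space[OF xy(1,3)] by (auto simp: weight_def)
qed

lemma weight_eigenvalue: "weight t f \<Longrightarrow> h \<in> t \<Longrightarrow> eigenvalue h (f h)"
  by (auto simp: weight_def eigenvalue_def root_space_def)

section \<open>Prime-field eigenvalues from three roots\<close>

lemma of_nat_neq_of_nat:
  "i < j \<Longrightarrow> j < CHAR('a) \<Longrightarrow> of_nat i \<noteq> (of_nat j :: 'a)"
  using of_nat_neq_0[of "j - i"] less_imp_diff_less[of j "CHAR('a)" i] by (auto simp: of_nat_diff)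

text \<open>Adding 1 repeatedly works from 2 on: the current value must differ from 0 and from 1 for
  \<open>eigenvalue_add\<close> to apply.\<close>

lemma eigenvalue_upward:
  assumes "eigenvalue h 1" "eigenvalue h (of_nat i)" "2 \<le> i" "i \<le> j" "j < CHAR('a)"
  shows "eigenvalue h (of_nat j)"
  using assms(4,5)
proof (induction j rule: dec_induct)
  case base
  then show ?case using assms(2) by simp
next
  case (step k)
  then have "eigenvalue h (of_nat k + 1)"
    using assms(1,3) of_nat_neq_0[of k] of_nat_neq_of_nat[of 1 k]
    by (intro eigenvalue_add) auto
  then show ?case
    by (simp add: add.commute)
qed

lemma eigenvalue_Nats:
  assumes "eigenvalue h 1" "eigenvalue h 2" "c \<in> \<nat>" "c \<noteq> 0"
  shows "eigenvalue h c"
proof -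
  obtain i where i: "i < CHAR('a)" "c = of_nat i"
    using assms(3) by (rule Nats_less_CHAR)
  have "i \<noteq> 0"
    using i(2) assms(4) of_nat_0 by metis
  then consider "i = 1" | "i \<ge> 2"
    by linarith
  then show ?thesis
    using assms(1) eigenvalue_upward[of h 2 i] assms(2) i by cases auto
qed

text \<open>First climb from \<open>c\<close> to -1 in steps of 1, then descend from
  \<open>c\<close> to 2 in steps of -1. The value -1 is excluded for \<open>c\<close> because 1 and
  -1 alone only yield 0.\<close>

lemma ex_eigenvalues_1_2:
  assumes "eigenvalue h 1" "eigenvalue h c" "c \<in> \<nat>" "c \<noteq> 0" "c \<noteq> 1" "c \<noteq> -1"
  shows "eigenvalue h 2"
proof -
  obtain i where i: "i < CHAR('a)" "c = of_nat i"
    using assms(3) by (rule Nats_less_CHAR)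
  have m1: "of_nat (CHAR('a) - 1) = (-1::'a)"
    using CHAR_gt_1 by (simp add: of_nat_diff)
  have "i \<noteq> 0" "i \<noteq> 1" "i \<noteq> CHAR('a) - 1"
    using i(2) assms(4-6) m1 of_nat_0 of_nat_1 by metis+
  then have i2: "2 \<le> i" "i < CHAR('a) - 1"
    using i by auto
  have neg: "eigenvalue h (-1)"
    using eigenvalue_upward[of h i "CHAR('a) - 1"] assms(1,2) i i2 m1 by auto
  have "2 \<le> j \<Longrightarrow> j \<le> i \<Longrightarrow> eigenvalue h (of_nat j)" for j
  proof (induction "i - j" arbitrary: j)
    case 0
    then show ?case using assms(2) i by simp
  next
    case (Suc d)
    then have "eigenvalue h (of_nat (Suc j))"
      by (intro Suc.hyps(1)) auto
    moreover have "of_nat (Suc j) \<noteq> (-1::'a)"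
      using of_nat_neq_of_nat[of "Suc j" "CHAR('a) - 1"] m1 Suc i2 by auto
    moreover have "of_nat (Suc j) \<noteq> (0::'a)"
      using of_nat_neq_0[of "Suc j"] Suc i2 by auto
    ultimately have "eigenvalue h (of_nat (Suc j) + (-1))"
      using neg by (intro eigenvalue_add) auto
    then show ?case by simp
  qed
  from this[of 2] show ?thesis
    using i2 by simp
qed

lemma three_roots_imp_eigenvalues_1_2:
  assumes t: "subspace t" and card: "card (roots t) \<ge> 3"
  shows "\<exists>h. eigenvalue h 1 \<and> eigenvalue h 2"
proof -
  obtain R where R: "R \<subseteq> roots t" "card R = 3"
    using card by (metis obtain_subset_with_card_n)
  then obtain a b c where abc: "a \<in> roots t" "b \<in> roots t" "c \<in> roots t" "a \<noteq> b" "a \<noteq> c" "b \<noteq> c"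
    by (auto simp: card_3_iff)
  have ext: "\<exists>h\<in>t. f h \<noteq> g h" if "f \<in> roots t" "g \<in> roots t" "f \<noteq> g" for f g
    using that by (auto simp: roots_def dual_def intro: extensionalityI)
  \<comment> \<open>Of the two roots \<open>b\<close> and \<open>c\<close>, at most one is the
    negative of \<open>a\<close>.\<close>
  have "\<exists>\<alpha>\<in>roots t. \<exists>\<beta>\<in>roots t. \<alpha> \<noteq> \<beta> \<and> (\<exists>h\<in>t. \<alpha> h \<noteq> - \<beta> h)"
  proof (cases "\<exists>h\<in>t. b h \<noteq> - a h")
    case True
    then show ?thesis using abc by metis
  next
    case False
    obtain h where "h \<in> t" "c h \<noteq> b h"
      using ext abc by metis
    then have "h \<in> t" "c h \<noteq> - a h"
      using False by auto
    then show ?thesis using abc by metis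
  qed
  then obtain \<alpha> \<beta> where R: "\<alpha> \<in> roots t" "\<beta> \<in> roots t" and neq: "\<alpha> \<noteq> \<beta>" "\<exists>h\<in>t. \<alpha> h \<noteq> - \<beta> h"
    by blast
  have neq': "\<exists>h\<in>t. \<alpha> h \<noteq> \<beta> h"
    using ext R neq(1) by blast
  have w: "weight t f" if "f \<in> roots t" for f
    using that subspace_0[OF subspace_root_space] by (fastforce simp: roots_def weight_def)
  have nz: "\<exists>h\<in>t. f h \<noteq> 0" if "f \<in> roots t" for f
    using that by (auto simp: roots_def)
  have sc: "f (scale c h) = c * f h" if "f \<in> roots t" "h \<in> t" for f c h
    using that by (auto simp: roots_def dual_def)
  have normalize: "\<exists>h\<in>t. f h = 1" if "f \<in> roots t" for f
  proof -
    obtain h where "h \<in> t" "f h \<noteq> 0"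
      using nz \<open>f \<in> roots t\<close> by blast
    then show ?thesis
      using t that by (intro bexI[of _ "scale (inverse (f h)) h"]) (auto simp: sc subspace_scale)
  qed
  show ?thesis
  proof (cases "\<exists>c\<in>\<nat>. \<forall>h\<in>t. \<alpha> h = c * \<beta> h")
    case True
    then obtain c where c: "c \<in> \<nat>" "\<forall>h\<in>t. \<alpha> h = c * \<beta> h"
      by blast
    obtain h where h: "h \<in> t" "\<beta> h = 1"
      using normalize R by blast
    have "c \<noteq> 0" "c \<noteq> 1" "c \<noteq> -1"
      using nz[OF R(1)] neq neq' c by auto
    moreover have "eigenvalue h 1" "eigenvalue h c"
      using weight_eigenvalue[OF w[OF R(1)] h(1)] weight_eigenvalue[OF w[OF R(2)] h(1)] h c by auto
    ultimately show ?thesis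
      using ex_eigenvalues_1_2 c(1) by blast
  next
    case False
    have False': "\<exists>h\<in>t. \<alpha> h \<noteq> c * \<beta> h" if "c \<in> \<nat>" for c
      using False that by blast
    have nz': "\<exists>h\<in>t. \<alpha> h + of_nat i * \<beta> h \<noteq> 0" for i
      using False'[OF Nats_minus[OF of_nat_in_Nats[of i]]] by (auto simp: eq_neg_iff_add_eq_0)
    \<comment> \<open>As \<open>\<alpha>\<close> is not a prime-field multiple of
      \<open>\<beta>\<close>, no member of this string is zero or equal to \<open>\<beta>\<close>,
      so the string never breaks.\<close>
    have W: "weight t (\<lambda>h. \<alpha> h + of_nat i * \<beta> h)" for i
    proof (induction i)
      case 0
      then show ?case using w[OF R(1)] by simp
    next
      case (Suc i)
      have "\<exists>h\<in>t. \<alpha> h \<noteq> (1 + - of_nat i) * \<beta> h"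
        by (intro False' Nats_add Nats_minus Nats_1 of_nat_in_Nats)
      then have "\<exists>h\<in>t. \<alpha> h + of_nat i * \<beta> h \<noteq> \<beta> h"
        by (auto simp: algebra_simps)
      from weight_add[OF Suc w[OF R(2)] nz' nz[OF R(2)] this]
      show ?case
        by (simp add: algebra_simps)
    qed
    have m1: "of_nat (CHAR('a) - 1) = (-1::'a)"
      using CHAR_gt_1 by (simp add: of_nat_diff)
    obtain h' where h': "h' \<in> t" "\<beta> h' = 1"
      using normalize R by blast
    then have ne: "\<alpha> h' + of_nat 1 * \<beta> h' \<noteq> \<alpha> h' + of_nat (CHAR('a) - 1) * \<beta> h'"
      unfolding m1 using numerals_neq_0(1) by (auto simp: eq_neg_iff_add_eq_0)
    \<comment> \<open>This is twice \<open>\<alpha>\<close>, written as the sum of the distinct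
      weights \<open>\<alpha> + \<beta>\<close> and \<open>\<alpha> - \<beta>\<close>, since
      \<open>weight_add\<close> cannot add \<open>\<alpha>\<close> to itself.\<close>
    have W2: "weight t (\<lambda>h. (\<alpha> h + of_nat 1 * \<beta> h) + (\<alpha> h + of_nat (CHAR('a) - 1) * \<beta> h))"
      using ne h'(1) by (intro weight_add W nz') blast
    obtain h where h: "h \<in> t" "\<alpha> h = 1"
      using normalize R by blast
    have "eigenvalue h 1"
      using weight_eigenvalue[OF w[OF R(1)] h(1)] h by simp
    moreover have "eigenvalue h 2"
      using weight_eigenvalue[OF W2 h(1)] h unfolding m1 by simp
    ultimately show ?thesis by blast
  qed
qed

section \<open>One-dimensional eigenspaces, the Witt-like string and the contradiction\<close>

lemma linear_lie_lie: "Vector_Spaces.linear scale scale (\<lambda>v. lie z (lie x v))"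
  by unfold_locales (simp_all add: lie_bilinear)

text \<open>If \<open>x\<close>, \<open>y\<close> were independent, then some nonzero \<open>w = y - \<mu> x\<close> would have \<open>ad z \<circ> ad w\<close>
  singular on the eigenspace of \<open>2 c\<close>, where \<open>z\<close> is an eigenvector for \<open>- c\<close>.\<close>

lemma eigenspace_one_dimensional:
  assumes "eigenvalue h 1" "eigenvalue h 2" and c: "c \<in> \<nat>" "c \<noteq> 0"
    and x: "lie h x = scale c x" "x \<noteq> 0" and y: "lie h y = scale c y"
  shows "\<exists>\<mu>. y = scale \<mu> x"
proof -
  have c2: "2 * c \<noteq> 0" "3 * c \<noteq> 0" "4 * c \<noteq> 0"
    using c(2) numerals_neq_0 by auto
  have ne: "c \<noteq> 2 * c"
    unfolding mult_2 add_cancel_right_right by (rule c(2))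
  have ne': "- c \<noteq> 3 * c"
    using c2(3) by (simp add: neg_eq_iff_add_eq_0)
  have e: "eigenvalue h (- c)" "eigenvalue h (2 * c)"
    using assms(1,2) c c2 Nats_minus[OF c(1)] Nats_add[OF c(1) c(1)]
    by (auto intro!: eigenvalue_Nats)
  obtain z where z: "z \<noteq> 0" "lie h z = scale (- c) z"
    using e by (auto simp: eigenvalue_def)
  obtain v0 where v0: "v0 \<noteq> 0" "lie h v0 = scale (2 * c) v0"
    using e by (auto simp: eigenvalue_def)
  define V where "V = {v. lie h v = scale (2 * c) v}"
  \<comment> \<open>The brackets pair eigenvalues \<open>c\<close> with \<open>2 * c\<close>, then
    \<open>- c\<close> with \<open>3 * c\<close>. They are distinct and nonzero because 2, 3 and 4
    are invertible.\<close>
  have inj: "lie z (lie w v) \<noteq> 0" if "v \<in> V" "v \<noteq> 0" "lie h w = scale c w" "w \<noteq> 0" for w v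
  proof -
    have v: "lie h v = scale (2 * c) v"
      using that by (simp add: V_def)
    have "lie w v \<noteq> 0"
      using lie_eigenvectors_nonzero[of h w c v "2 * c"] that v c c2 ne by simp
    moreover have "lie h (lie w v) = scale (c + 2 * c) (lie w v)"
      using that v by (intro lie_eigenvector)
    ultimately show ?thesis
      using lie_eigenvectors_nonzero[of h z "- c" "lie w v" "3 * c"] z c c2 ne' by (simp add: algebra_simps)
  qed
  have stable: "(\<lambda>v. lie z (lie w v)) ` V \<subseteq> V" if "lie h w = scale c w" for w
  proof safe
    fix v assume "v \<in> V"
    then have "lie h (lie z (lie w v)) = scale (- c + (c + 2 * c)) (lie z (lie w v))"
      using that z by (intro lie_eigenvector) (auto simp: V_def)
    then show "lie z (lie w v) \<in> V"
      by (simp add: V_def)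
  qed
  have "\<exists>\<mu>. \<exists>v\<in>V. v \<noteq> 0 \<and> lie z (lie y v) = scale \<mu> (lie z (lie x v))"
  proof (rule ex_pencil_eigenvector)
    show "subspace V"
      using subspace_root_space[of "{h}" "\<lambda>_. 2 * c"] by (simp add: root_space_def V_def)
  qed (use v0 stable x y inj linear_lie_lie in \<open>auto simp: V_def\<close>)
  then obtain \<mu> v where v: "v \<in> V" "v \<noteq> 0" "lie z (lie y v) = scale \<mu> (lie z (lie x v))"
    by blast
  then have "lie z (lie (y - scale \<mu> x) v) = 0"
    by (simp add: lie_bilinear)
  moreover have "lie h (y - scale \<mu> x) = scale c (y - scale \<mu> x)"
    using x y by (simp add: lie_bilinear scale_right_diff_distrib mult.commute)
  ultimately have "y - scale \<mu> x = 0"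
    using inj v by blast
  then show ?thesis by auto
qed

text \<open>Here \<open>x\<close>, \<open>e0\<close>, \<open>e1\<close> imitate the Witt algebra
  elements of degrees -1, 0, 1, and \<open>e\<close> imitates the top element. The brackets of
  \<open>e0\<close> and \<open>e1\<close> with the string \<open>F\<close> are computed in terms of
  one scalar \<open>a\<close>, except \<open>lie e1 e = scale b x\<close>.\<close>

lemma eigenvalues_1_2_imp_False:
  assumes "eigenvalue h 1" "eigenvalue h 2"
  shows False
proof -
  obtain n where p: "CHAR('a) = n + 5"
    using CHAR_ge_5 by (metis add.commute le_Suc_ex)
  have "of_nat (n + 5) = (0::'a)"
    using of_nat_CHAR[where 'a='a] unfolding p .
  then have n: "of_nat n = (-5::'a)"
    by (simp add: eq_neg_iff_add_eq_0)
  have m1: "(-1::'a) \<in> \<nat>" "(-2::'a) \<in> \<nat>"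
    using Nats_minus[of 1] Nats_minus[of 2] by auto
  obtain x where x: "x \<noteq> 0" "lie h x = scale (-1) x"
    using eigenvalue_Nats[OF assms m1(1)] by (auto simp: eigenvalue_def)
  obtain e where e: "e \<noteq> 0" "lie h e = scale (-2) e"
    using eigenvalue_Nats[OF assms m1(2)] numerals_neq_0 by (auto simp: eigenvalue_def)
  \<comment> \<open>The eigenvalues run through -2, -3 and so on. With \<open>p = n + 5\<close>, the
    indices \<open>n + 2\<close>, \<open>n + 3\<close>, \<open>n + 4\<close> belong to 1, 0,
    -1.\<close>
  define F where "F k = (lie x ^^ k) e" for k
  have xF: "lie x (F k) = F (Suc k)" for k
    by (simp add: F_def)
  have F0: "F 0 = e"
    by (simp add: F_def)
  have hF: "lie h (F k) = scale (- (of_nat k + 2)) (F k)" for k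
  proof (induction k)
    case 0
    then show ?case using e F0 by simp
  next
    case (Suc k)
    show ?case
      using lie_eigenvector[OF x(2) Suc] by (simp add: xF algebra_simps)
  qed
  have k2: "- (of_nat k + (2::'a)) \<noteq> 0" if "k \<le> n + 2" for k
    using of_nat_neq_0[of "k + 2"] that p unfolding of_nat_add neg_equal_0_iff_equal by simp
  have k1: "-1 \<noteq> - (of_nat k + (2::'a))" if "k \<le> n + 2" for k
    using of_nat_neq_of_nat[of 1 "k + 2"] that p unfolding of_nat_add neg_equal_iff_equal by simp
  have xinj: "lie x v \<noteq> 0" if "lie h v = scale (- (of_nat k + 2)) v" "v \<noteq> 0" "k \<le> n + 2" for v k
    by (rule lie_eigenvectors_nonzero[OF x(2,1) that(1,2) _ k2[OF that(3)] k1[OF that(3)]]) simp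
  have Fnz: "F k \<noteq> 0" if "k \<le> n + 3" for k
    using that
  proof (induction k)
    case 0
    then show ?case using e F0 by simp
  next
    case (Suc k)
    then show ?case
      using xinj[OF hF, of k] xF[of k] by simp
  qed
  have Nk: "- (of_nat k + 2) \<in> (\<nat> :: 'a set)" for k
    by (intro Nats_minus Nats_add) auto
  have oneF: "\<exists>c. v = scale c (F k)" if "lie h v = scale (- (of_nat k + 2)) v" "k \<le> n + 2" for v k
    by (rule eigenspace_one_dimensional[OF assms Nk k2[OF that(2)] hF Fnz that(1)]) (use that in simp)
  define e0 e1 where "e0 = F (n + 3)" and "e1 = F (n + 2)"
  have he0: "lie h e0 = scale 0 e0" and he1: "lie h e1 = scale 1 e1"
    using hF[of "n + 3"] hF[of "n + 2"] by (simp_all add: e0_def e1_def n)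
  have xe1: "lie x e1 = e0" and xF1: "lie x (F (Suc n)) = e1"
    using xF[of "n + 2"] xF[of "Suc n"] by (simp_all add: e0_def e1_def numeral_eq_Suc)
  have e1x: "lie e1 x = - e0"
    using lie_skew[of e1 x] xe1 by simp

  obtain m where m: "lie e0 x = scale m x"
    using eigenspace_one_dimensional[OF assms m1(1) _ x(2,1), of "lie e0 x"] lie_eigenvector[OF he0 x(2)]
    by auto
  have "\<exists>c. lie e0 (F k) = scale c (F k)" if "k \<le> n + 2" for k
    using oneF[of "lie e0 (F k)" k] lie_eigenvector[OF he0 hF, of k] that by simp
  then obtain l where l: "\<And>k. k \<le> n + 2 \<Longrightarrow> lie e0 (F k) = scale (l k) (F k)"
    by metis
  have l_Suc: "l (Suc k) = m + l k" if "Suc k \<le> n + 2" for k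
  proof -
    have "scale (l (Suc k)) (F (Suc k)) = lie e0 (lie x (F k))"
      using l[OF that] by (simp add: xF)
    also have "\<dots> = lie (lie e0 x) (F k) + lie x (lie e0 (F k))"
      by (rule lie_lie)
    also have "\<dots> = scale (m + l k) (F (Suc k))"
      using l[of k] that by (simp add: m lie_bilinear xF scale_left_distrib)
    finally show ?thesis
      using Fnz[of "Suc k"] that by simp
  qed
  have l_eq: "l k = l 0 + of_nat k * m" if "k \<le> n + 2" for k
    using that by (induction k) (auto simp: l_Suc algebra_simps)
  have hF1: "lie h (F (Suc n)) = scale 2 (F (Suc n))" and hFn: "lie h (F n) = scale 3 (F n)"
    using hF[of "Suc n"] hF[of n] by (simp_all add: n)
  have e1F1: "lie e1 (F (Suc n)) \<noteq> 0"
    by (rule lie_eigenvectors_nonzero[OF he1 _ hF1]) (use Fnz numerals_neq_0 of_nat_neq_of_nat[of 1 2] p in \<open>auto simp: e1_def\<close>)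
  have "lie h (lie e1 (F (Suc n))) = scale 3 (lie e1 (F (Suc n)))"
    using lie_eigenvector[OF he1 hF1] by simp
  then obtain c where c: "lie e1 (F (Suc n)) = scale c (F n)"
    using oneF[of _ n] by (auto simp: n)
  have c0: "c \<noteq> 0"
    using e1F1 c by auto
  \<comment> \<open>Letting \<open>ad e0\<close> act as a derivation on this nonzero multiple of
    \<open>F n\<close> ties the start of the arithmetic progression \<open>l\<close> to its
    difference \<open>m\<close>.\<close>
  have "scale (l n) (lie e1 (F (Suc n))) = lie e0 (lie e1 (F (Suc n)))"
    by (simp add: c lie_bilinear l mult.commute)
  also have "\<dots> = scale (l (n + 2) + l (Suc n)) (lie e1 (F (Suc n)))"
    using l[of "n + 2"] l[of "Suc n"]
    by (simp add: lie_lie[of e0] e1_def lie_bilinear scale_left_distrib)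
  finally have "l n = l (n + 2) + l (Suc n)"
    using e1F1 by simp
  then have "l 0 + -5 * m = (l 0 + -3 * m) + (l 0 + -4 * m)"
    using l_eq[of n] l_eq[of "n + 2"] l_eq[of "Suc n"] by (simp add: n)
  then have l0: "l 0 = 2 * m"
    by algebra
  define a where "a = - m"
  have e0x: "lie x e0 = scale a x"
    using lie_skew[of x e0] m by (simp add: a_def)
  have Fn4: "F (n + 4) = scale a x"
    using xF[of "n + 3"] e0x by (simp add: e0_def numeral_eq_Suc)
  have Fn5: "F (n + 5) = 0"
    using xF[of "n + 4"] Fn4 by (simp add: lie_bilinear lie_self numeral_eq_Suc)
  \<comment> \<open>On the string, \<open>e0\<close> acts as \<open>a\<close> times
    \<open>h\<close>.\<close>
  have e0F: "lie e0 (F k) = scale (- a * (of_nat k + 2)) (F k)" if k: "k \<le> n + 4" for k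
  proof -
    consider "k \<le> n + 2" | "k = n + 3" | "k = n + 4"
      using k by linarith
    then show ?thesis
    proof cases
      case 1
      then show ?thesis
        using l_eq[of k] by (simp add: l l0 a_def algebra_simps)
    next
      case 2
      then show ?thesis
        by (simp add: n lie_self flip: e0_def)
    next
      case 3
      show ?thesis
        unfolding 3 Fn4 by (simp add: n lie_bilinear m a_def)
    qed
  qed
  \<comment> \<open>Computing the bracket with \<open>x\<close> in two ways gives
    \<open>c = 2 * a\<close>, whence \<open>a\<close> is nonzero.\<close>
  have "scale c (F (Suc n)) = lie x (lie e1 (F (Suc n)))"
    by (simp add: c lie_bilinear xF)
  also have "\<dots> = scale (2 * a) (F (Suc n))"
    using e0F[of "Suc n"] by (simp add: lie_lie[of x] xe1 xF1 lie_self n)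
  finally have "c = 2 * a"
    using Fnz[of "Suc n"] by simp
  then have a0: "a \<noteq> 0"
    using c0 by auto

  \<comment> \<open>Descending induction from \<open>k = n + 1\<close>, where
    \<open>F (Suc k)\<close> is \<open>e1\<close> and the factor \<open>k + 4\<close> is
    \<open>p\<close>. Each step is checked after applying \<open>ad x\<close>.\<close>
  have e1F_upper: "lie e1 (F (Suc k)) = scale (a * (of_nat k + 1) * (of_nat k + 4) / 2) (F k)"
    if "k \<le> n + 1" for k
    using that
  proof (induction k rule: inc_induct)
    case base
    then show ?case
      by (simp add: n lie_self e1_def)
  next
    case (step k)
    have "lie h (lie e1 (F (Suc k))) = scale (- (of_nat k + 2)) (lie e1 (F (Suc k)))"
      using lie_eigenvector[OF he1 hF, of "Suc k"] by simp
    then obtain d where d: "lie e1 (F (Suc k)) = scale d (F k)"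
      using oneF[of _ k] step by auto
    have "scale d (F (Suc k)) = lie x (lie e1 (F (Suc k)))"
      by (simp add: d lie_bilinear xF)
    also have "\<dots> = lie e0 (F (Suc k)) + lie e1 (F (Suc (Suc k)))"
      by (simp add: lie_lie[of x] xe1 xF)
    also have "\<dots> = scale (- a * (of_nat k + 3) + a * (of_nat k + 2) * (of_nat k + 5) / 2) (F (Suc k))"
    proof -
      have *: "of_nat (Suc k) + 1 = (of_nat k + 2 :: 'a)" "of_nat (Suc k) + 2 = (of_nat k + 3 :: 'a)"
        "of_nat (Suc k) + 4 = (of_nat k + 5 :: 'a)"
        by simp_all
      have "Suc k \<le> n + 4"
        using step by simp
      from e0F[OF this] step.IH show ?thesis
        unfolding * scale_left_distrib by metis
    qed
    finally have "d = - a * (of_nat k + 3) + a * (of_nat k + 2) * (of_nat k + 5) / 2"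
      using Fnz[of "Suc k"] step by simp
    then show ?case
      using numerals_neq_0(1) by (simp add: d field_simps)
  qed
  have e1F: "lie e1 (F (Suc k)) = scale (a * (of_nat k + 1) * (of_nat k + 4) / 2) (F k)"
    if k: "k \<le> n + 3" for k
  proof -
    consider "k \<le> n + 1" | "k = n + 2" | "k = n + 3"
      using k by linarith
    then show ?thesis
    proof cases
      case 1
      then show ?thesis by (rule e1F_upper)
    next
      case 2
      have "F (Suc k) = e0"
        by (simp add: 2 e0_def numeral_eq_Suc)
      then have "lie e1 (F (Suc k)) = scale (- a) e1"
        using lie_skew[of e1 e0] e0F[of "n + 2", folded e1_def] by (simp add: n)
      also have "- a = a * (of_nat k + 1) * (of_nat k + 4) / 2"
        using numerals_neq_0(1) by (simp add: 2 n field_simps)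
      finally show ?thesis
        by (simp add: 2 e1_def)
    next
      case 3
      have "F (Suc k) = scale a x"
        using Fn4 by (simp add: 3 numeral_eq_Suc)
      then have "lie e1 (F (Suc k)) = scale (- a) e0"
        by (simp add: lie_bilinear e1x)
      also have "- a = a * (of_nat k + 1) * (of_nat k + 4) / 2"
        using numerals_neq_0(1) by (simp add: 3 n field_simps)
      finally show ?thesis
        by (simp add: 3 e0_def)
    qed
  qed
  have "lie h (lie e1 (F 0)) = scale (- 1) (lie e1 (F 0))"
    using lie_eigenvector[OF he1 hF, of 0] by simp
  then obtain b where b: "lie e1 (F 0) = scale b x"
    using eigenspace_one_dimensional[OF assms m1(1) _ x(2,1)] by auto

  define g where "g k = inverse (of_nat (fact k) :: 'a)" for k
  have fact_Suc': "of_nat (fact (Suc k)) = (of_nat k + 1) * (of_nat (fact k) :: 'a)" for k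
    by (simp add: algebra_simps)
  have fact_nz: "of_nat (fact k) \<noteq> (0::'a)" if "k \<le> n + 4" for k
    using that
  proof (induction k)
    case (Suc k)
    then show ?case
      using of_nat_neq_0[of "Suc k"] p unfolding fact_Suc' by (simp add: add.commute)
  qed simp
  have g_Suc: "g (Suc k) * (of_nat k + 1) = g k" if "Suc k \<le> n + 4" for k
    using fact_nz[OF that] unfolding g_def fact_Suc' inverse_mult_distrib mult_eq_0_iff by simp
  have gn: "g (n + 4) \<noteq> 0"
    using fact_nz by (simp add: g_def)
  \<comment> \<open>With this \<open>s\<close>, the coefficient
    \<open>b - 3/2 * a^2 * g (n + 4) * s^p\<close> of \<open>x\<close> in \<open>lie y1 y2\<close>
    is zero.\<close>
  obtain s :: 'a where s: "s ^ (n + 5) = 2 * b / (3 * a ^ 2 * g (n + 4))"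
    using nth_root_exists[of "n + 5"] by auto

  \<comment> \<open>\<open>y1\<close> and \<open>y2\<close> are the images of \<open>e1\<close> and \<open>e\<close> under the truncated exponential of
    \<open>s (ad x)\<close>. As \<open>ad x\<close> is nilpotent, they are eigenvectors of \<open>h'\<close>; but the truncated exponential
    need not preserve the bracket, and the error term is proportional to \<open>s^p\<close>.\<close>
  define h' where "h' = h + scale s x"
  define y1 where "y1 = e1 + scale s e0 + scale (s ^ 2 * a / 2) x"
  define y2 where "y2 = (\<Sum>k<n + 5. scale (s ^ k * g k) (F k))"
  have xx: "lie x h = x"
    using x(2) lie_skew[of x h] by simp
  have h'y1: "lie h' y1 = scale 1 y1"
  proof -
    have "lie h' y1 = e1 + (scale (- (s ^ 2 * a / 2)) x) + (scale s e0 + scale (s ^ 2 * a) x)"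
      by (simp add: h'_def y1_def lie_bilinear he1 he0 x xe1 e0x lie_self scale_right_distrib power2_eq_square mult.assoc)
    also have "\<dots> = e1 + scale s e0 + scale (- (s ^ 2 * a / 2) + s ^ 2 * a) x"
      unfolding scale_left_distrib by (simp only: add_ac)
    also have "- (s ^ 2 * a / 2) + s ^ 2 * a = s ^ 2 * a / 2"
      using numerals_neq_0(1) by (simp add: field_simps)
    finally show ?thesis
      by (simp add: y1_def)
  qed
  \<comment> \<open>An index shift without boundary terms: \<open>w 0\<close> vanishes at the bottom
    and \<open>F (n + 5)\<close> at the top.\<close>
  have shift: "(\<Sum>k<n + 5. scale (u k) (F (Suc k))) = (\<Sum>k<n + 5. scale (w k) (F k))"
    if "w 0 = 0" "\<And>k. Suc k \<le> n + 4 \<Longrightarrow> w (Suc k) = u k" for u w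
  proof -
    have "(\<Sum>k<n + 5. scale (w k) (F k)) = (\<Sum>k<n + 4. scale (w (Suc k)) (F (Suc k)))"
      using that(1) by (simp add: sum.lessThan_Suc_shift numeral_eq_Suc del: sum.lessThan_Suc)
    also have "\<dots> = (\<Sum>k<n + 4. scale (u k) (F (Suc k)))"
      using that(2) by (intro sum.cong) auto
    also have "\<dots> = (\<Sum>k<Suc (n + 4). scale (u k) (F (Suc k)))"
      using Fn5 by (simp add: numeral_eq_Suc)
    finally show ?thesis
      by (simp add: numeral_eq_Suc del: sum.lessThan_Suc)
  qed
  have h'y2: "lie h' y2 = scale (-2) y2"
  proof -
    have "lie h' y2 = (\<Sum>k<n + 5. scale (- (of_nat k + 2) * (s ^ k * g k)) (F k))
        + (\<Sum>k<n + 5. scale (s ^ Suc k * g k) (F (Suc k)))"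
      by (simp add: h'_def y2_def lie_sum_right lie_bilinear hF xF sum.distrib[symmetric] scale_right_distrib
          mult_ac scale_sum_right del: sum.lessThan_Suc)
    also have "(\<Sum>k<n + 5. scale (s ^ Suc k * g k) (F (Suc k)))
        = (\<Sum>k<n + 5. scale (s ^ k * g k * of_nat k) (F k))"
      by (rule shift) (auto simp: g_Suc[symmetric] algebra_simps)
    finally show ?thesis
      unfolding y2_def scale_sum_right
      by (simp add: sum.distrib[symmetric] scale_left_distrib[symmetric] algebra_simps)
  qed
  have y1y2: "lie y1 y2 = 0"
  proof -
    let ?s = "\<lambda>k. s ^ Suc k * g k * a"
    have "lie y1 y2 = (\<Sum>k<n + 5. scale (s ^ k * g k) (lie e1 (F k)))
        + (\<Sum>k<n + 5. scale (s ^ Suc k * g k) (lie e0 (F k)))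
        + (\<Sum>k<n + 5. scale (s ^ k * g k * (s ^ 2 * a / 2)) (F (Suc k)))"
      by (simp add: y1_def y2_def lie_sum_right lie_bilinear xF sum.distrib scale_right_distrib mult_ac)
    also have "(\<Sum>k<n + 5. scale (s ^ k * g k) (lie e1 (F k)))
        = scale b x + (\<Sum>k<n + 4. scale (?s k * ((of_nat k + 4) / 2)) (F k))"
    proof -
      have "(\<Sum>k<n + 5. scale (s ^ k * g k) (lie e1 (F k)))
        = scale b x + (\<Sum>k<n + 4. scale (s ^ Suc k * g (Suc k)) (lie e1 (F (Suc k))))"
        by (simp add: sum.lessThan_Suc_shift numeral_eq_Suc b g_def del: sum.lessThan_Suc)
      also have "(\<Sum>k<n + 4. scale (s ^ Suc k * g (Suc k)) (lie e1 (F (Suc k))))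
          = (\<Sum>k<n + 4. scale (?s k * ((of_nat k + 4) / 2)) (F k))"
        by (intro sum.cong) (auto simp: e1F g_Suc[symmetric] mult_ac)
      finally show ?thesis .
    qed
    also have "(\<Sum>k<n + 5. scale (s ^ Suc k * g k) (lie e0 (F k)))
        = (\<Sum>k<n + 5. scale (?s k * - (of_nat k + 2)) (F k))"
    proof (rule sum.cong)
      fix k assume "k \<in> {..<n + 5}"
      then have "lie e0 (F k) = scale (a * - (of_nat k + 2)) (F k)"
        using e0F[of k] unfolding minus_mult_commute by (auto simp del: minus_add_distrib)
      then show "scale (s ^ Suc k * g k) (lie e0 (F k)) = scale (?s k * - (of_nat k + 2)) (F k)"
        by (simp only: scale_scale mult_ac)
    qed simp
    also have "(\<Sum>k<n + 5. scale (s ^ k * g k * (s ^ 2 * a / 2)) (F (Suc k)))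
        = (\<Sum>k<n + 5. scale (?s k * (of_nat k / 2)) (F k))"
      by (rule shift) (auto simp: g_Suc[symmetric] mult_ac power2_eq_square)
    \<comment> \<open>The top index is split off because the sum coming from \<open>e1\<close> stops
      one term earlier; below it the three coefficients cancel.\<close>
    also have "scale b x + (\<Sum>k<n + 4. scale (?s k * ((of_nat k + 4) / 2)) (F k))
        + (\<Sum>k<n + 5. scale (?s k * - (of_nat k + 2)) (F k))
        + (\<Sum>k<n + 5. scale (?s k * (of_nat k / 2)) (F k))
      = scale b x + scale (?s (n + 4) * (- (of_nat (n + 4) + 2) + of_nat (n + 4) / 2)) (F (n + 4))
        + (\<Sum>k<n + 4. scale (?s k * ((of_nat k + 4) / 2 - (of_nat k + 2) + of_nat k / 2)) (F k))"
    proof -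
      have *: "(\<Sum>k<n + 5. f k) = (\<Sum>k<n + 4. f k) + f (n + 4)" for f :: "nat \<Rightarrow> 'b"
        using sum.lessThan_Suc[of f "n + 4"] by (simp add: numeral_eq_Suc del: sum.lessThan_Suc)
      show ?thesis
        unfolding * diff_conv_add_uminus distrib_left scale_left_distrib sum.distrib
        by (simp only: add_ac)
    qed
    also have "(\<Sum>k<n + 4. scale (?s k * ((of_nat k + 4) / 2 - (of_nat k + 2) + of_nat k / 2)) (F k)) = 0"
      using numerals_neq_0(1) by (intro sum.neutral) (auto simp: field_simps)
    also have "?s (n + 4) * (- (of_nat (n + 4) + 2) + of_nat (n + 4) / 2) = s ^ (n + 5) * g (n + 4) * a * (- 3 / 2)"
      using numerals_neq_0(1) by (simp add: n field_simps)
    also have "\<dots> = - b / a"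
      unfolding s using numerals_neq_0 mult_eq_0_iff[of 2 "3::'a"] gn a0 by (simp add: field_simps power2_eq_square)
    finally show ?thesis
      using a0 by (simp add: Fn4)
  qed
  have "y1 \<noteq> 0"
  proof
    \<comment> \<open>Two applications of \<open>ad x\<close> leave only \<open>scale a x\<close>;
      for \<open>y2\<close> below, \<open>n + 4\<close> applications do the same.\<close>
    assume "y1 = 0"
    then have "lie x (lie x y1) = 0"
      by (simp add: lie_bilinear)
    then have "scale a x = 0"
      by (simp add: y1_def lie_bilinear xe1 e0x lie_self)
    then show False
      using a0 x by simp
  qed
  moreover have "y2 \<noteq> 0"
  proof
    assume y2: "y2 = 0"
    have "(lie x ^^ j) y2 = (\<Sum>k<n + 5. scale (s ^ k * g k) (F (k + j)))" for j
      by (induction j) (simp_all add: y2_def lie_sum_right lie_scale_right xF del: sum.lessThan_Suc)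
    moreover have "(lie x ^^ j) 0 = 0" for j
      by (induction j) (auto simp: lie_bilinear)
    ultimately have "0 = (\<Sum>k<n + 5. scale (s ^ k * g k) (F (k + (n + 4))))"
      using y2 by metis
    also have "\<dots> = (\<Sum>k\<in>{0}. scale (s ^ k * g k) (F (k + (n + 4))))"
    proof (rule sum.mono_neutral_right)
      have "F (n + 5 + k) = 0" for k
        by (induction k) (simp_all only: add_Suc_right add_0_right Fn5 xF[symmetric] lie_zero_right)
      then have "F (k + (n + 4)) = 0" if "k \<noteq> 0" for k
        using that by (cases k) (auto simp: add_ac numeral_eq_Suc)
      then show "\<forall>k\<in>{..<n + 5} - {0}. scale (s ^ k * g k) (F (k + (n + 4))) = 0"
        by auto
    qed auto
    also have "\<dots> = scale a x"
      by (simp add: g_def Fn4)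
    finally show False
      using a0 x by simp
  qed
  ultimately show False
    using lie_eigenvectors_nonzero[OF h'y1 _ h'y2] y1y2 numerals_neq_0 by (auto simp: eq_neg_iff_add_eq_0)
qed

end

section \<open>Maximal tori and the \<open>p\<close>-rank\<close>

context finite_dim_restricted_lie_algebra
begin

lemma torus_zero: "torus {0}"
  by (auto simp: torus_def p_subalgebra_def lie_subalgebra_def abelian_def lie_bilinear pmap_zero)

lemma Tor_nonempty: "Tor \<noteq> {}"
proof -
  have "\<exists>t. torus t \<and> (\<forall>t'. torus t' \<longrightarrow> dim t' \<le> dim t)"
    by (rule ex_has_greatest_nat[of torus "{0}" dim "Suc dimension"])
      (auto simp: torus_zero less_Suc_eq_le dim_subset_UNIV)
  then show ?thesis
    by (auto simp: Tor_def)
qed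

text \<open>The choice in \<open>num_roots\<close> returns a genuine torus because
  \<open>Tor\<close> is nonempty.\<close>

lemma subspace_some_Tor: "subspace (SOME t. t \<in> Tor)"
proof -
  have "(SOME t. t \<in> Tor) \<in> Tor"
    using Tor_nonempty by (simp add: some_in_eq)
  then show ?thesis
    by (simp add: Tor_def torus_def p_subalgebra_def lie_subalgebra_def)
qed

text \<open>Dimensions are bounded, so the \<open>Max\<close> in \<open>p_rank\<close> is taken over
  a finite set and is meaningful.\<close>

lemma le_p_rank:
  assumes "elementary r \<noteq> {}"
  shows "r \<le> p_rank"
proof -
  have "{r. elementary r \<noteq> {}} \<subseteq> {..dimension}"
    using dim_subset_UNIV by (auto simp: elementary_def)
  then have "finite {r. elementary r \<noteq> {}}"
    by (rule finite_subset) simp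
  then show ?thesis
    using assms by (simp add: p_rank_def)
qed

end

theorem corollary4p2p6:
  fixes scale :: "'a::alg_closed_field \<Rightarrow> 'b::ab_group_add \<Rightarrow> 'b"
    and lie :: "'b \<Rightarrow> 'b \<Rightarrow> 'b"
    and pmap :: "'b \<Rightarrow> 'b"
    and Basis :: "'b set"
  assumes "CHAR('a) \<ge> 5"
    and "restricted_lie_algebra scale lie pmap"
    and "finite_dimensional_vector_space scale Basis"
    and "restricted_lie_algebra.num_roots scale lie pmap \<ge> 3"
  shows "restricted_lie_algebra.elementary scale lie pmap 2 \<noteq> {} \<and>
    restricted_lie_algebra.p_rank scale lie pmap \<ge> 2"
proof -
  interpret restricted_lie_algebra scale lie pmap by fact
  interpret finite_dimensional_vector_space scale Basis by fact
  interpret finite_dim_restricted_lie_algebra scale lie pmap Basis ..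
  have el: "elementary 2 \<noteq> {}"
  proof
    assume "elementary 2 = {}"
    then interpret no_elementary_plane scale lie pmap Basis
      using assms(1) by unfold_locales
    show False
      using three_roots_imp_eigenvalues_1_2[OF subspace_some_Tor] assms(4) eigenvalues_1_2_imp_False
      unfolding num_roots_def by blast
  qed
  then show ?thesis
    using le_p_rank by blast
qed

end
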